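(* Let $C$ be an arbitrary bivariate copula, let $C^t(x,y):=C(y,x)$ be its transpose, and let $K_C$ and $K_{C^t}$ be Markov kernels of $C$ and $C^t$, respectively. Let $f\in L^1(\mathbb{I}^2,\mathcal{B}(\mathbb{I}^2),\lambda_2)$ denote the Radon–Nikodym derivative of $\mu_C$, i.e., the density of the absolutely continuous component $\mu_C^{abs}$ of $\mu_C$. Then $$\partial_yK_C(x,[0,y])=f(x,y)=\partial_xK_{C^t}(y,[0,x])$$ holds for $\lambda_2$-almost every $(x,y)\in\mathbb{I}^2$.
   Context: $\mathbb{I}=[0,1]$; $\lambda,\lambda_2$ are Lebesgue measure on $\mathbb{I},\mathbb{I}^2$. A bivariate copula is the restriction to $\mathbb{I}^2$ of a bivariate distribution function with uniform marginals on $\mathbb{I}$; $\mu_C$ is the doubly stochastic measure with $\mu_C([0,x]\times[0,y])=C(x,y)$. A Markov kernel $K_C:\mathbb{I}\times\mathcal{B}(\mathbb{I})\to\mathbb{I}$ of $C$ is a version of the regular conditional distribution of $Y$ given $X$ where $(X,Y)\sim C$; i.e., $x\mapsto K_C(x,E)$ is Borel measurable for each $E$, $K_C(x,\cdot)$ is a probability measure for each $x$, and $\mu_C(G)=\int_{\mathbb{I}}K_C(x,G_x)\,d\lambda(x)$ for all Borel $G\subseteq\mathbb{I}^2$, with $G_x=\{y:(x,y)\in G\}$. $\mu_C^{abs}$ is the absolutely continuous part (with respect to $\lambda_2$) of $\mu_C$. $\partial_y$, $\partial_x$ denote partial derivatives with respect to $y$, $x$ (and the identity includes the assertion that these derivatives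 exist). *)

theory Defs
  imports "HOL-Probability.Probability"
begin

text \<open>Lebesgue measure on the Borel sets of the unit interval and of the unit square.\<close>

abbreviation unit_leb :: "real measure" where
  "unit_leb \<equiv> restrict_space lborel {0..1}"

abbreviation square_leb :: "(real \<times> real) measure" where
  "square_leb \<equiv> restrict_space lborel ({0..1} \<times> {0..1})"

definition bivariate_cdf :: "(real \<times> real) measure \<Rightarrow> real \<Rightarrow> real \<Rightarrow> real" where
  "bivariate_cdf P x y = measure P ({..x} \<times> {..y})"

text \<open>Only the values on the unit square matter; \<open>C\<close> is arbitrary elsewhere.\<close>

definition copula :: "(real \<Rightarrow> real \<Rightarrow> real) \<Rightarrow> bool" where
  "copula C \<longleftrightarrow> (\<exists>P. prob_space P \<and> sets P = sets borel \<and>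
     distr P borel fst = uniform_measure lborel {0..1} \<and>
     distr P borel snd = uniform_measure lborel {0..1} \<and>
     (\<forall>x\<in>{0..1}. \<forall>y\<in>{0..1}. C x y = bivariate_cdf P x y))"

definition doubly_stochastic :: "(real \<times> real) measure \<Rightarrow> bool" where
  "doubly_stochastic \<mu> \<longleftrightarrow> sets \<mu> = sets square_leb \<and>
     (\<forall>E\<in>sets unit_leb. emeasure \<mu> (E \<times> {0..1}) = emeasure unit_leb E \<and>
                         emeasure \<mu> ({0..1} \<times> E) = emeasure unit_leb E)"

definition measure_of_copula :: "(real \<Rightarrow> real \<Rightarrow> real) \<Rightarrow> (real \<times> real) measure \<Rightarrow> bool" where
  "measure_of_copula C \<mu> \<longleftrightarrow> doubly_stochastic \<mu> \<and>
     (\<forall>x\<in>{0..1}. \<forall>y\<in>{0..1}. measure \<mu> ({0..x} \<times> {0..y}) = C x y)"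

definition copula_measure :: "(real \<Rightarrow> real \<Rightarrow> real) \<Rightarrow> (real \<times> real) measure" where
  "copula_measure C = (THE \<mu>. measure_of_copula C \<mu>)"

definition transpose_copula :: "(real \<Rightarrow> real \<Rightarrow> real) \<Rightarrow> real \<Rightarrow> real \<Rightarrow> real" where
  "transpose_copula C = (\<lambda>x y. C y x)"

text \<open>Membership in \<^term>\<open>unit_leb \<rightarrow>\<^sub>M prob_algebra unit_leb\<close> says that every \<open>K x\<close> is a
  probability measure on the Borel sets of the unit interval and that \<open>x \<mapsto> K x E\<close> is Borel
  measurable for every Borel set \<open>E\<close>.\<close>

definition markov_kernel :: "(real \<Rightarrow> real \<Rightarrow> real) \<Rightarrow> (real \<Rightarrow> real measure) \<Rightarrow> bool" where
  "markov_kernel C K \<longleftrightarrow> K \<in> unit_leb \<rightarrow>\<^sub>M prob_algebra unit_leb \<and>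
     (\<forall>G\<in>sets square_leb.
        emeasure (copula_measure C) G = (\<integral>\<^sup>+x. emeasure (K x) {y. (x, y) \<in> G} \<partial>unit_leb))"

definition mutually_singular :: "'a measure \<Rightarrow> 'a measure \<Rightarrow> bool" where
  "mutually_singular M N \<longleftrightarrow> (\<exists>S\<in>sets M. emeasure N S = 0 \<and> emeasure M (space M - S) = 0)"

definition lebesgue_decomposition ::
    "'a measure \<Rightarrow> 'a measure \<Rightarrow> 'a measure \<Rightarrow> 'a measure \<Rightarrow> bool" where
  "lebesgue_decomposition M N N_abs N_sing \<longleftrightarrow>
     sets N = sets M \<and> sets N_abs = sets M \<and> sets N_sing = sets M \<and>
     (\<forall>G\<in>sets M. emeasure N G = emeasure N_abs G + emeasure N_sing G) \<and>
     absolutely_continuous M N_abs \<and> mutually_singular M N_sing"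

text \<open>\<open>f\<close> is a version of the density, with respect to \<open>M\<close>, of the absolutely continuous component
  of the finite measure \<open>N\<close>. That component is unique, so the existential quantifier merely names
  it.\<close>

definition ac_density :: "'a measure \<Rightarrow> 'a measure \<Rightarrow> ('a \<Rightarrow> real) \<Rightarrow> bool" where
  "ac_density M N f \<longleftrightarrow> integrable M f \<and>
     (\<exists>N_abs N_sing. lebesgue_decomposition M N N_abs N_sing \<and>
        (\<forall>G\<in>sets M. measure N_abs G = (LINT z:G|M. f z)))"

text \<open>The definite description in \<^const>\<open>copula_measure\<close> is justified.\<close>

lemma measure_of_copula_unique:
  assumes "measure_of_copula C \<mu>" "measure_of_copula C \<nu>"
  shows "\<mu> = \<nu>"
proof -
  let ?Q = "{0..1::real} \<times> {0..1::real}"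
  have Q: "?Q \<in> sets borel"
    by (intro borel_closed closed_Times) auto
  have facts: "sets \<rho> = sets (restrict_space borel ?Q) \<and> space \<rho> = ?Q \<and> finite_measure \<rho> \<and>
      (\<lambda>z. z) \<in> \<rho> \<rightarrow>\<^sub>M borel" if "measure_of_copula C \<rho>" for \<rho>
  proof -
    have s: "sets \<rho> = sets (restrict_space borel ?Q)"
      using that by (simp add: measure_of_copula_def doubly_stochastic_def sets_restrict_space)
    then have sp: "space \<rho> = ?Q"
      by (simp add: sets_eq_imp_space_eq space_restrict_space)
    have "{0..1} \<in> sets unit_leb"
      by (simp add: sets_restrict_space_iff)
    then have "emeasure \<rho> ?Q = emeasure unit_leb {0..1}"
      using that unfolding measure_of_copula_def doubly_stochastic_def by blast
    also have "\<dots> = 1"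
      by (simp add: emeasure_restrict_space)
    finally have "finite_measure \<rho>"
      by (intro finite_measureI) (simp add: sp)
    moreover have "(\<lambda>z. z) \<in> \<rho> \<rightarrow>\<^sub>M borel"
      using measurable_restrict_space1[OF measurable_ident, of borel ?Q] s
      by (simp add: id_def cong: measurable_cong_sets)
    ultimately show ?thesis using s sp by blast
  qed
  define m where "m \<rho> = distr \<rho> borel (\<lambda>z::real \<times> real. z)" for \<rho>
  have rect: "emeasure (m \<rho>) {..(a, b)} =
      (if a < 0 \<or> b < 0 then 0 else ennreal (C (min a 1) (min b 1)))"
    if "measure_of_copula C \<rho>" for \<rho> and a b :: real
  proof -
    interpret finite_measure \<rho> using facts[OF that] by blast
    have "emeasure (m \<rho>) {..(a, b)} = emeasure \<rho> ({..(a, b)} \<inter> ?Q)"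
      unfolding m_def using facts[OF that] by (subst emeasure_distr) auto
    also have "{..(a, b)} \<inter> ?Q = (if a < 0 \<or> b < 0 then {} else {0..min a 1} \<times> {0..min b 1})"
      by (auto simp: less_eq_prod_def)
    finally show ?thesis
      using that by (auto simp: emeasure_eq_measure measure_of_copula_def)
  qed
  have "m \<mu> = m \<nu>"
  proof (rule measure_eqI_generator_eq[where \<Omega> = UNIV and
        E = "range (\<lambda>a. {..a::real \<times> real})" and A = "\<lambda>n. {..(real n, real n)}"])
    show "Int_stable (range (\<lambda>a. {..a::real \<times> real}))"
    proof (rule Int_stableI_image)
      fix a b :: "real \<times> real"
      have "{..a} \<inter> {..b} = {..inf a b}" by auto
      then show "\<exists>c\<in>UNIV. {..a} \<inter> {..b} = {..c}" by blast
    qed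
    show "emeasure (m \<mu>) X = emeasure (m \<nu>) X" if "X \<in> range (\<lambda>a. {..a})" for X
      using that rect[OF assms(1)] rect[OF assms(2)] by auto
    have "sets (borel :: (real \<times> real) measure) = sigma_sets UNIV (range (\<lambda>a. {..a}))"
      by (subst borel_eq_atMost) simp
    then show "sets (m \<mu>) = sigma_sets UNIV (range (\<lambda>a. {..a}))"
      "sets (m \<nu>) = sigma_sets UNIV (range (\<lambda>a. {..a}))"
      by (simp_all add: m_def)
    show "(\<Union>n. {..(real n, real n)}) = UNIV"
    proof (intro equalityI subsetI UNIV_I)
      fix z :: "real \<times> real"
      obtain n where "max (fst z) (snd z) \<le> real n" using real_arch_simple by blast
      then show "z \<in> (\<Union>n. {..(real n, real n)})"
        by (auto simp: less_eq_prod_def)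
    qed
    show "emeasure (m \<mu>) {..(real i, real i)} \<noteq> \<infinity>" for i
      by (simp add: rect[OF assms(1)])
  qed auto
  show ?thesis
  proof (rule measure_eqI)
    show "sets \<mu> = sets \<nu>"
      using facts assms by metis
    fix G assume "G \<in> sets \<mu>"
    then have "G \<in> sets borel" "G \<subseteq> ?Q"
      using facts[OF assms(1)] Q by (auto simp: sets_restrict_space_iff)
    moreover have "emeasure (m \<rho>) G = emeasure \<rho> G"
      if "measure_of_copula C \<rho>" "G \<in> sets borel" "G \<subseteq> ?Q" for \<rho>
      unfolding m_def using facts[OF that(1)] that
      by (subst emeasure_distr) (auto simp: Int_absorb2)
    ultimately show "emeasure \<mu> G = emeasure \<nu> G"
      using assms \<open>m \<mu> = m \<nu>\<close> by metis
  qed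
qed

lemma measure_of_copula_exists:
  assumes "copula C"
  shows "\<exists>\<mu>. measure_of_copula C \<mu>"
proof -
  let ?I = "{0..1::real}"
  obtain P where P: "prob_space P" "sets P = sets borel"
    "distr P borel fst = uniform_measure lborel ?I"
    "distr P borel snd = uniform_measure lborel ?I"
    "\<And>x y. x \<in> ?I \<Longrightarrow> y \<in> ?I \<Longrightarrow> C x y = bivariate_cdf P x y"
    using assms by (auto simp: copula_def)
  interpret prob_space P by fact
  have [simp]: "space P = UNIV"
    using P(2) by (simp add: sets_eq_imp_space_eq)
  have prod: "A \<times> B \<in> sets P" if "A \<in> sets borel" "B \<in> sets borel" for A B :: "real set"
    using that by (simp add: P(2) borel_prod[symmetric])
  have marg: "emeasure P (E \<times> UNIV) = emeasure lborel (?I \<inter> E)"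
    "emeasure P (UNIV \<times> E) = emeasure lborel (?I \<inter> E)" if "E \<in> sets borel" for E
  proof -
    have "fst \<in> P \<rightarrow>\<^sub>M borel" "snd \<in> P \<rightarrow>\<^sub>M borel"
      using measurable_fst[of "borel :: real measure" "borel :: real measure"]
        measurable_snd[of "borel :: real measure" "borel :: real measure"]
      unfolding borel_prod measurable_cong_sets[OF P(2) refl] .
    then have "emeasure (distr P borel fst) E = emeasure P (E \<times> UNIV)"
      "emeasure (distr P borel snd) E = emeasure P (UNIV \<times> E)"
      using that by (auto simp: emeasure_distr intro!: arg_cong[where f = "emeasure P"])
    then show "emeasure P (E \<times> UNIV) = emeasure lborel (?I \<inter> E)"
      "emeasure P (UNIV \<times> E) = emeasure lborel (?I \<inter> E)"
      using that by (simp_all add: P(3,4) divide_ennreal_def)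
  qed
  have "emeasure lborel (?I \<inter> - ?I) = 0" by simp
  then have null: "(- ?I) \<times> UNIV \<in> null_sets P" "UNIV \<times> (- ?I) \<in> null_sets P"
    using marg[of "- ?I"] prod[of "- ?I" UNIV] prod[of UNIV "- ?I"] by auto
  have cut: "emeasure P ((A \<inter> ?I) \<times> (B \<inter> ?I)) = emeasure P (A \<times> B)"
    if "A \<in> sets borel" "B \<in> sets borel" for A B
  proof (rule emeasure_eq_AE)
    show "AE z in P. (z \<in> (A \<inter> ?I) \<times> (B \<inter> ?I)) = (z \<in> A \<times> B)"
      using AE_not_in[OF null(1)] AE_not_in[OF null(2)] by eventually_elim auto
  qed (use that in \<open>auto intro!: prod\<close>)
  have Q: "?I \<times> ?I \<in> sets P" by (intro prod) auto
  define \<mu> where "\<mu> = restrict_space P (?I \<times> ?I)"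
  have em: "emeasure \<mu> G = emeasure P G" if "G \<subseteq> ?I \<times> ?I" for G
    unfolding \<mu>_def using Q that by (intro emeasure_restrict_space) auto
  have "measure_of_copula C \<mu>"
    unfolding measure_of_copula_def doubly_stochastic_def
  proof (intro conjI ballI)
    show "sets \<mu> = sets square_leb"
      by (simp add: \<mu>_def sets_restrict_space P(2))
  next
    fix E assume "E \<in> sets unit_leb"
    then have E: "E \<in> sets borel" "E \<subseteq> ?I" by (auto simp: sets_restrict_space_iff)
    then have eq: "E \<inter> ?I = E" "?I \<inter> E = E" by auto
    show "emeasure \<mu> (E \<times> ?I) = emeasure unit_leb E"
      using E cut[of E UNIV] marg(1)[of E] by (subst em) (auto simp: eq emeasure_restrict_space)
    show "emeasure \<mu> (?I \<times> E) = emeasure unit_leb E"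
      using E cut[of UNIV E] marg(2)[of E] by (subst em) (auto simp: eq emeasure_restrict_space)
  next
    fix x y assume xy: "x \<in> ?I" "y \<in> ?I"
    then have "{..x} \<inter> ?I = {0..x}" "{..y} \<inter> ?I = {0..y}" by auto
    then have "emeasure \<mu> ({0..x} \<times> {0..y}) = emeasure P ({..x} \<times> {..y})"
      using xy cut[of "{..x}" "{..y}"] by (subst em) auto
    then show "measure \<mu> ({0..x} \<times> {0..y}) = C x y"
      using xy P(5) by (simp add: bivariate_cdf_def measure_def)
  qed
  then show ?thesis by blast
qed

lemma measure_of_copula_copula_measure:
  assumes "copula C"
  shows "measure_of_copula C (copula_measure C)"
  unfolding copula_measure_def
  using measure_of_copula_exists[OF assms] measure_of_copula_unique by (metis theI)

end

theory Submission
  imports Defs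
begin

text \<open>
  A finite Borel measure vanishing on \<open>A\<close> has symmetric derivative \<open>0\<close> at Lebesgue-almost every point
  of \<open>A\<close>, by Vitali covering and outer regularity. Let \<open>N\<close> be a null set of the square carrying the
  singular part of \<open>\<mu>\<close>; then for almost every \<open>x\<close> the kernel measure off the section \<open>N\<^sub>x\<close> has
  density \<open>f(x, \<cdot>)\<close>. For rational \<open>r\<close>, the vanishing result applied to the singular part and to the
  densities \<open>(f(x, \<cdot>) - r)\<^sup>+\<close> and \<open>(r - f(x, \<cdot>))\<^sup>+\<close> squeezes the difference quotients of
  \<open>y \<mapsto> K(x, [0, y])\<close> to \<open>f(x, y)\<close> for almost every \<open>y\<close>. Right continuity makes the set of good points
  measurable, since rational increments suffice, and Fubini yields the claim. The transposed kernel
  reduces to the first case by reflecting the square.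
\<close>

section \<open>Symmetric derivatives of finite Borel measures on the line\<close>

lemma finite_borel_measureI:
  assumes "sets M = sets borel" "emeasure M UNIV < \<infinity>"
  shows "finite_borel_measure M"
  using assms sets_eq_imp_space_eq[OF assms(1)]
  by (intro finite_borel_measure.intro finite_measureI finite_borel_measure_axioms.intro) auto

context finite_borel_measure
begin

text \<open>A ball of radius \<open>h\<close> with mass above \<open>c * h\<close> has length
  \<open>2 * h\<close>, which is below \<open>2 / c\<close> times its mass. Such balls inside an
  open superset \<open>U\<close> of \<open>A\<close> form a Vitali cover of the exceptional points,
  so a disjoint selection has total length at most \<open>2 / c\<close> times the small mass of
  \<open>U\<close>.\<close>

lemma negligible_upper_density_pos:
  assumes A: "A \<in> sets borel" "emeasure M A = 0" and "0 < c"
  shows "negligible {x \<in> A. \<exists>\<^sub>F h in at_right 0. c * h < measure M (cball x h)}" (is "negligible ?S")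
  unfolding negligible_outer_le
proof (intro allI impI)
  fix e :: real assume "0 < e"
  have "(INF U \<in> {U. A \<subseteq> U \<and> open U}. emeasure M U) = 0"
    using outer_regular[of M A] M_is_borel emeasure_finite A by simp
  \<comment> \<open>The bound on the mass of \<open>U\<close> is chosen so that the factor
    \<open>2 / c\<close> turns it into \<open>e\<close>.\<close>
  then have "(INF U \<in> {U. A \<subseteq> U \<and> open U}. emeasure M U) < ennreal (e * c / 2)"
    using \<open>0 < e\<close> \<open>0 < c\<close> by simp
  then obtain U where U: "A \<subseteq> U" "open U" "emeasure M U < ennreal (e * c / 2)"
    unfolding INF_less_iff by blast
  define K where "K = {(x, h). 0 < h \<and> cball x h \<subseteq> U \<and> c * h < measure M (cball x h)}"
  have K_pos: "0 < snd i" and K_sub: "cball (fst i) (snd i) \<subseteq> U" if "i \<in> K" for i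
    using that by (cases i; simp add: K_def)+
  have "\<exists>i. i \<in> K \<and> x \<in> cball (fst i) (snd i) \<and> snd i < d" if x: "x \<in> ?S" and "0 < d" for x d
  proof -
    obtain \<epsilon> where \<epsilon>: "0 < \<epsilon>" "cball x \<epsilon> \<subseteq> U"
      using x U open_contains_cball by blast
    \<comment> \<open>Heavy radii occur frequently near 0 and every small radius keeps the ball
      inside \<open>U\<close>, so radii with both properties exist below any \<open>d\<close>: the
      cover is fine in the sense of Vitali.\<close>
    have ev: "\<forall>\<^sub>F h in at_right 0. h \<in> {0<..<min d \<epsilon>}"
      using \<open>0 < d\<close> \<epsilon> by (intro eventually_at_right_real) auto
    obtain h where "c * h < measure M (cball x h)" "h \<in> {0<..<min d \<epsilon>}"
      using frequently_ex[OF frequently_eventually_frequently[OF _ ev]] x by blast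
    moreover have "cball x h \<subseteq> U"
      using calculation(2) \<epsilon> subset_cball[of h \<epsilon> x] by auto
    ultimately show ?thesis
      by (intro exI[of _ "(x, h)"]) (auto simp: K_def)
  qed
  then obtain D where D: "countable D" "D \<subseteq> K"
    "pairwise (\<lambda>i j. disjnt (cball (fst i) (snd i)) (cball (fst j) (snd j))) D"
    "negligible (?S - (\<Union>i\<in>D. cball (fst i) (snd i)))"
    using Vitali_covering_theorem_cballs[of K snd ?S fst, OF K_pos] by blast
  let ?B = "\<lambda>i. cball (fst i) (snd i) :: real set"
  have disj: "disjoint_family_on ?B D"
    using D(3) by (auto simp: disjoint_family_on_def pairwise_def disjnt_def)
  have "emeasure lborel (\<Union>i\<in>D. ?B i) = (\<integral>\<^sup>+i. emeasure lborel (?B i) \<partial>count_space D)"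
    using D(1) disj by (intro emeasure_UN_countable) auto
  also have "\<dots> \<le> (\<integral>\<^sup>+i. ennreal (2 / c) * emeasure M (?B i) \<partial>count_space D)"
  proof (intro nn_integral_mono)
    fix i assume "i \<in> space (count_space D)"
    then have i: "0 < snd i" "c * snd i < measure M (?B i)"
      using D(2) by (auto simp: K_def)
    then have "2 * snd i \<le> 2 / c * measure M (?B i)"
      using \<open>0 < c\<close> by (simp add: field_simps)
    then have "ennreal (2 * snd i) \<le> ennreal (2 / c * measure M (?B i))"
      by (rule ennreal_leI)
    also have "\<dots> = ennreal (2 / c) * emeasure M (?B i)"
      using \<open>0 < c\<close> by (simp add: emeasure_eq_measure flip: ennreal_mult)
    finally show "emeasure lborel (?B i) \<le> ennreal (2 / c) * emeasure M (?B i)"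
      using i by (simp add: cball_eq_atLeastAtMost)
  qed
  also have "\<dots> = ennreal (2 / c) * (\<integral>\<^sup>+i. emeasure M (?B i) \<partial>count_space D)"
    by (intro nn_integral_cmult) auto
  also have "(\<integral>\<^sup>+i. emeasure M (?B i) \<partial>count_space D) = emeasure M (\<Union>i\<in>D. ?B i)"
    using D(1) disj M_is_borel by (intro emeasure_UN_countable[symmetric]) auto
  also have "\<dots> \<le> emeasure M U"
    using D(2) U(2) M_is_borel by (intro emeasure_mono UN_least K_sub) auto
  also have "\<dots> \<le> ennreal (e * c / 2)"
    using U(3) by simp
  finally have le: "emeasure lborel (\<Union>i\<in>D. ?B i) \<le> ennreal e"
    using \<open>0 < c\<close> \<open>0 < e\<close> by (simp add: mult_left_mono ennreal_mult'[symmetric])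
  have "(\<Union>i\<in>D. ?B i) \<in> sets borel"
    using D(1) by (intro sets.countable_UN') auto
  then have eq: "emeasure lebesgue (\<Union>i\<in>D. ?B i) = emeasure lborel (\<Union>i\<in>D. ?B i)"
    and m: "(\<Union>i\<in>D. ?B i) \<in> sets lebesgue"
    by auto
  have B: "(\<Union>i\<in>D. ?B i) \<in> lmeasurable"
    using le m by (intro fmeasurableI) (auto simp: eq intro: le_less_trans)
  have le_e: "measure lebesgue (\<Union>i\<in>D. ?B i) \<le> e"
    using le \<open>0 < e\<close> unfolding eq[symmetric]
    by (simp add: emeasure_eq_measure2[OF B])
  \<comment> \<open>The points of \<open>?S\<close> missed by the selected balls are known to be
    null only in the completed sense, so the final cover is measured in
    \<open>lebesgue\<close>.\<close>
  define R where "R = ?S - (\<Union>i\<in>D. ?B i)"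
  have R: "R \<in> null_sets lebesgue"
    using D(4) by (simp add: R_def negligible_iff_null_sets)
  have "?S \<subseteq> (\<Union>i\<in>D. ?B i) \<union> R"
    by (auto simp: R_def)
  moreover have "(\<Union>i\<in>D. ?B i) \<union> R \<in> lmeasurable"
    by (rule fmeasurable.Un[OF B fmeasurableI_null_sets[OF R]])
  moreover have "measure lebesgue ((\<Union>i\<in>D. ?B i) \<union> R) \<le> e"
    using le_e m R by (simp add: measure_Un_null_set)
  ultimately show "\<exists>T. ?S \<subseteq> T \<and> T \<in> lmeasurable \<and> measure lebesgue T \<le> e"
    by blast
qed

text \<open>Letting \<open>c\<close> run through the reciprocals of the positive integers leaves
  countably many exceptional sets.\<close>

lemma AE_symmetric_derivative_zero:
  assumes A: "A \<in> sets borel" "emeasure M A = 0"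
  shows "AE x in lborel. x \<in> A \<longrightarrow> (\<forall>c>0. \<forall>\<^sub>F h in at_right 0. measure M (cball x h) \<le> c * h)"
proof -
  have "AE x in lborel. x \<in> A \<longrightarrow>
      (\<forall>\<^sub>F h in at_right 0. measure M (cball x h) \<le> inverse (real (Suc n)) * h)" for n
  proof -
    let ?S = "{x \<in> A. \<exists>\<^sub>F h in at_right 0. inverse (real (Suc n)) * h < measure M (cball x h)}"
    have "?S \<in> null_sets (completion lborel)"
      using negligible_upper_density_pos[OF A, of "inverse (real (Suc n))"]
      by (simp add: negligible_iff_null_sets)
    \<comment> \<open>A Borel null superset brings the statement from completed Lebesgue measure
      back to \<open>lborel\<close>.\<close>
    then obtain N where "N \<in> null_sets lborel" "?S \<subseteq> N"
      unfolding null_sets_completion_iff2 by blast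
    then show ?thesis
      by (intro AE_I'[of N]) (auto simp: frequently_def not_less)
  qed
  then have "AE x in lborel. \<forall>n. x \<in> A \<longrightarrow>
      (\<forall>\<^sub>F h in at_right 0. measure M (cball x h) \<le> inverse (real (Suc n)) * h)"
    by (subst AE_all_countable) simp
  then show ?thesis
  proof eventually_elim
    case (elim x)
    show ?case
    proof (intro impI allI)
      fix c :: real assume "x \<in> A" "0 < c"
      then obtain n where n: "inverse (real (Suc n)) < c"
        using reals_Archimedean by blast
      have "\<forall>\<^sub>F h in at_right (0::real). 0 < h"
        by (simp add: eventually_at_right_less)
      with elim[rule_format, OF \<open>x \<in> A\<close>, of n]
      show "\<forall>\<^sub>F h in at_right 0. measure M (cball x h) \<le> c * h"
      proof eventually_elim
        case (elim h)
        then show ?case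
          using mult_right_mono[of "inverse (real (Suc n))" c h] n by linarith
      qed
    qed
  qed
qed

text \<open>For rationals \<open>s < g y < r\<close> the mass of a short interval at
  \<open>y\<close> is compared with \<open>s\<close> and \<open>r\<close> times its length. The
  error terms are measures that vanish on sets containing \<open>y\<close>, so at almost every such
  \<open>y\<close> they are of smaller order than the length.\<close>

lemma AE_has_real_derivative_distribution:
  assumes g [measurable]: "g \<in> borel_measurable borel" and g_nonneg: "\<And>y. 0 \<le> g y"
    and N: "N \<in> null_sets lborel"
    and eq: "density M (indicator (- N)) = density lborel (\<lambda>y. ennreal (g y))"
  shows "AE y in lborel. ((\<lambda>v. measure M {..v}) has_real_derivative g y) (at y)"
proof -
  note [measurable_cong] = M_is_borel
  have [measurable]: "N \<in> sets borel"
    using N by auto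
  have ac: "emeasure M (B - N) = (\<integral>\<^sup>+y\<in>B. ennreal (g y) \<partial>lborel)" if [measurable]: "B \<in> sets borel" for B
  proof -
    have "emeasure M (B - N) = emeasure (density M (indicator (- N))) B"
      using M_is_borel by (simp add: emeasure_restricted Diff_eq Int_commute)
    then show ?thesis
      by (simp add: eq emeasure_density)
  qed
  \<comment> \<open>Since \<open>ennreal\<close> sends negative reals to 0, the densities of
    \<open>U r\<close> and \<open>W r n\<close> are positive parts: the excess of \<open>g\<close>
    over \<open>r\<close> and its deficit below \<open>r\<close>.\<close>
  define U where "U r = density lborel (\<lambda>y. ennreal (g y - real_of_rat r))" for r
  define V where "V = density M (indicator N)"
  \<comment> \<open>the truncation to \<open>{- n..n}\<close> makes this measure finite\<close>
  define W where "W r n = density lborel (\<lambda>y. ennreal (real_of_rat r - g y) * indicator {- real n..real n} y)" for r n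
  have sets [simp, measurable_cong]: "sets (U r) = sets borel" "sets V = sets borel" "sets (W r n) = sets borel" for r n
    by (simp_all add: U_def V_def W_def M_is_borel)
  have eU: "emeasure (U r) B = (\<integral>\<^sup>+y\<in>B. ennreal (g y - real_of_rat r) \<partial>lborel)"
    if "B \<in> sets borel" for r B
    using that by (simp add: U_def emeasure_density)
  have eW: "emeasure (W r n) B = (\<integral>\<^sup>+y\<in>B. ennreal (real_of_rat r - g y) * indicator {- real n..real n} y \<partial>lborel)"
    if "B \<in> sets borel" for r n B
    using that by (simp add: W_def emeasure_density)
  have eV: "emeasure V B = emeasure M (B \<inter> N)" if "B \<in> sets borel" for B
    using that M_is_borel unfolding V_def by (simp add: emeasure_restricted Int_commute)
  \<comment> \<open>For \<open>0 \<le> r\<close> the excess is dominated by \<open>g\<close>, whose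
    integral is the mass of \<open>M\<close> off \<open>N\<close>. For negative \<open>r\<close> the
    measure \<open>U r\<close> would be infinite.\<close>
  have finU: "finite_borel_measure (U r)" if "0 \<le> r" for r
  proof -
    have "emeasure (U r) UNIV \<le> (\<integral>\<^sup>+y\<in>UNIV. ennreal (g y) \<partial>lborel)"
      unfolding eU[of UNIV, OF sets.top[of borel, unfolded space_borel]]
      using that by (intro nn_integral_mono mult_right_mono ennreal_leI) simp_all
    also have "\<dots> = emeasure M (UNIV - N)"
      by (intro ac[symmetric]) simp
    also have "\<dots> < \<infinity>"
      using emeasure_finite[of "UNIV - N"] by (simp only: less_top infinity_ennreal_def)
    finally show ?thesis
      by (intro finite_borel_measureI) (simp_all only: sets)
  qed
  have finV: "finite_borel_measure V"
    using emeasure_finite by (intro finite_borel_measureI) (simp_all add: eV less_top[symmetric])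
  have finW: "finite_borel_measure (W r n)" for r n
  proof -
    have "real_of_rat r - g y \<le> \<bar>real_of_rat r\<bar>" for y
      using g_nonneg[of y] by linarith
    then have "emeasure (W r n) UNIV \<le> (\<integral>\<^sup>+y. ennreal \<bar>real_of_rat r\<bar> * indicator {- real n..real n} y \<partial>lborel)"
      unfolding eW[of UNIV, OF sets.top[of borel, unfolded space_borel]]
      by (intro nn_integral_mono) (simp add: mult_right_mono ennreal_leI)
    also have "\<dots> < \<infinity>"
      by (simp add: nn_integral_cmult_indicator ennreal_mult_less_top)
    finally show ?thesis
      by (intro finite_borel_measureI) (simp_all only: sets)
  qed
  \<comment> \<open>The exceptional set depends on \<open>r\<close>; with \<open>r\<close> rational
    the union of these sets is still null.\<close>
  have aeU: "AE y in lborel. \<forall>r::rat. 0 \<le> r \<longrightarrow> g y \<le> real_of_rat r \<longrightarrow>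
      (\<forall>c>0. \<forall>\<^sub>F h in at_right 0. measure (U r) (cball y h) \<le> c * h)"
    unfolding AE_all_countable
  proof
    fix r :: rat
    have "emeasure (U r) {y. g y \<le> real_of_rat r} = 0"
      by (subst eU) (auto simp: nn_integral_0_iff_AE indicator_def ennreal_eq_0_iff)
    then have "0 \<le> r \<Longrightarrow> AE y in lborel. y \<in> {y. g y \<le> real_of_rat r} \<longrightarrow>
      (\<forall>c>0. \<forall>\<^sub>F h in at_right 0. measure (U r) (cball y h) \<le> c * h)"
      by (intro finite_borel_measure.AE_symmetric_derivative_zero finU) auto
    then show "AE y in lborel. 0 \<le> r \<longrightarrow> g y \<le> real_of_rat r \<longrightarrow>
      (\<forall>c>0. \<forall>\<^sub>F h in at_right 0. measure (U r) (cball y h) \<le> c * h)"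
      by (cases "0 \<le> r") auto
  qed
  have aeW: "AE y in lborel. \<forall>r::rat. \<forall>n. real_of_rat r \<le> g y \<longrightarrow>
      (\<forall>c>0. \<forall>\<^sub>F h in at_right 0. measure (W r n) (cball y h) \<le> c * h)"
    unfolding AE_all_countable
  proof (intro allI)
    fix r :: rat and n
    have "emeasure (W r n) {y. real_of_rat r \<le> g y} = 0"
      by (subst eW) (auto simp: nn_integral_0_iff_AE indicator_def ennreal_eq_0_iff)
    then have "AE y in lborel. y \<in> {y. real_of_rat r \<le> g y} \<longrightarrow>
      (\<forall>c>0. \<forall>\<^sub>F h in at_right 0. measure (W r n) (cball y h) \<le> c * h)"
      by (intro finite_borel_measure.AE_symmetric_derivative_zero finW) auto
    then show "AE y in lborel. real_of_rat r \<le> g y \<longrightarrow>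
      (\<forall>c>0. \<forall>\<^sub>F h in at_right 0. measure (W r n) (cball y h) \<le> c * h)"
      by simp
  qed
  have aeV: "AE y in lborel. y \<in> - N \<longrightarrow>
      (\<forall>c>0. \<forall>\<^sub>F h in at_right 0. measure V (cball y h) \<le> c * h)"
    by (intro finite_borel_measure.AE_symmetric_derivative_zero finV) (auto simp: eV)
  \<comment> \<open>The upper estimate takes \<open>x = g y\<close> and \<open>z = r\<close>, the
    lower one \<open>x = s\<close> and \<open>z = g y\<close>.\<close>
  have split: "ennreal x \<le> ennreal z + ennreal (x - z)" for x z
    by (cases "0 \<le> z"; cases "z \<le> x")
      (auto simp: ennreal_neg ennreal_leI add_increasing2 simp flip: ennreal_plus)
  have upper: "measure M {a<..b} \<le> real_of_rat r * (b - a) + measure (U r) {a<..b} + measure V {a<..b}"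
    if "a \<le> b" "0 \<le> r" for a b r
  proof -
    interpret U: finite_borel_measure "U r" by (rule finU) fact
    interpret V: finite_borel_measure V by (rule finV)
    have "emeasure M ({a<..b} - N) \<le> (\<integral>\<^sup>+y. ennreal (real_of_rat r) * indicator {a<..b} y + ennreal (g y - real_of_rat r) * indicator {a<..b} y \<partial>lborel)"
      using split by (subst ac) (auto intro!: nn_integral_mono simp: indicator_def)
    also have "\<dots> = ennreal (real_of_rat r * (b - a)) + emeasure (U r) {a<..b}"
      using that by (subst nn_integral_add) (auto simp: nn_integral_cmult_indicator eU ennreal_mult'')
    finally have le: "emeasure M ({a<..b} - N) \<le> ennreal (real_of_rat r * (b - a)) + emeasure (U r) {a<..b}" .
    have "emeasure M {a<..b} = emeasure M ({a<..b} - N) + emeasure M ({a<..b} \<inter> N)"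
      using M_is_borel by (subst plus_emeasure) (auto simp: Un_Diff_Int)
    also have "\<dots> \<le> ennreal (real_of_rat r * (b - a)) + emeasure (U r) {a<..b} + emeasure V {a<..b}"
      using le by (simp add: eV add_right_mono)
    finally show ?thesis
      using that by (simp add: emeasure_eq_measure U.emeasure_eq_measure V.emeasure_eq_measure flip: ennreal_plus)
  qed
  have lower: "real_of_rat s * (b - a) \<le> measure M {a<..b} + measure (W s n) {a<..b}"
    if "a \<le> b" "{a<..b} \<subseteq> {- real n..real n}" for a b s n
  proof -
    interpret W: finite_borel_measure "W s n" by (rule finW)
    \<comment> \<open>A negative \<open>s\<close> is harmless here, because truncation makes both
      sides 0.\<close>
    have "ennreal (real_of_rat s * (b - a)) = (\<integral>\<^sup>+y. ennreal (real_of_rat s) * indicator {a<..b} y \<partial>lborel)"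
      using that by (simp add: nn_integral_cmult_indicator ennreal_mult'')
    also have "\<dots> \<le> (\<integral>\<^sup>+y. ennreal (g y) * indicator {a<..b} y +
        ennreal (real_of_rat s - g y) * indicator {- real n..real n} y * indicator {a<..b} y \<partial>lborel)"
      using that(2) split by (intro nn_integral_mono) (auto simp: indicator_def)
    also have "\<dots> = emeasure M ({a<..b} - N) + emeasure (W s n) {a<..b}"
      by (subst nn_integral_add) (auto simp: eW ac)
    also have "\<dots> \<le> emeasure M {a<..b} + emeasure (W s n) {a<..b}"
      by (intro add_right_mono emeasure_mono) (auto simp: M_is_borel)
    finally show ?thesis
      by (simp add: emeasure_eq_measure W.emeasure_eq_measure flip: ennreal_plus)
  qed
  show ?thesis
    using aeU aeV aeW AE_not_in[OF N]
  proof eventually_elim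
    case (elim y)
    show ?case
      unfolding DERIV_def
    proof (rule LIM_I)
      fix e :: real assume "0 < e"
      \<comment> \<open>Error budget: \<open>r\<close> and \<open>s\<close> each cost
        \<open>e / 4\<close>. The upper bound then spends \<open>e / 4\<close> on each of
        \<open>U r\<close> and \<open>V\<close>, the lower bound \<open>e / 4\<close> on
        \<open>W s n\<close>.\<close>
      obtain r where r: "g y < real_of_rat r" "real_of_rat r < g y + e / 4"
        using of_rat_dense[of "g y" "g y + e / 4"] \<open>0 < e\<close> by auto
      obtain s where s: "g y - e / 4 < real_of_rat s" "real_of_rat s < g y"
        using of_rat_dense[of "g y - e / 4" "g y"] \<open>0 < e\<close> by auto
      \<comment> \<open>Increments will be kept below 1, so the intervals at \<open>y\<close> lie in
        \<open>{- real n..real n}\<close>, where \<open>W s n\<close> sees the whole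
        deficit.\<close>
      obtain n where n: "\<bar>y\<bar> + 1 \<le> real n"
        using real_arch_simple by blast
      have "0 \<le> real_of_rat r"
        using r(1) g_nonneg[of y] by linarith
      then have r0: "0 \<le> r"
        by simp
      have c: "0 < e / 4"
        using \<open>0 < e\<close> by simp
      have "\<forall>\<^sub>F h in at_right 0. measure (U r) (cball y h) \<le> e / 4 * h"
        "\<forall>\<^sub>F h in at_right 0. measure V (cball y h) \<le> e / 4 * h"
        "\<forall>\<^sub>F h in at_right 0. measure (W s n) (cball y h) \<le> e / 4 * h"
        by (rule elim(1)[rule_format, OF r0 _ c] elim(2)[rule_format, OF _ c] elim(3)[rule_format, OF _ c];
          use r s elim(4) in simp)+
      moreover have "\<forall>\<^sub>F h in at_right 0. h < (1::real)"
        unfolding eventually_at_right_field by (intro exI[of _ 1]) auto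
      ultimately have "\<forall>\<^sub>F h in at_right 0. measure (U r) (cball y h) \<le> e / 4 * h \<and>
          measure V (cball y h) \<le> e / 4 * h \<and> measure (W s n) (cball y h) \<le> e / 4 * h \<and> h < 1"
        by eventually_elim auto
      then obtain d where d: "0 < d" "\<forall>h>0. h < d \<longrightarrow> measure (U r) (cball y h) \<le> e / 4 * h \<and>
          measure V (cball y h) \<le> e / 4 * h \<and> measure (W s n) (cball y h) \<le> e / 4 * h \<and> h < 1"
        unfolding eventually_at_right_field by blast
      have "norm ((measure M {..y + h} - measure M {..y}) / h - g y) < e"
        if "h \<noteq> 0 \<and> norm (h - 0) < d" for h
      proof -
        have h: "h \<noteq> 0" "\<bar>h\<bar> < d" and h_pos: "0 < \<bar>h\<bar>"
          using that by simp_all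
        \<comment> \<open>Ordering the end points treats both signs of \<open>h\<close> at once. The
          interval lies in the ball of radius \<open>\<bar>h\<bar>\<close> about \<open>y\<close>,
          which is why symmetric derivatives of the error measures suffice.\<close>
        define a b where "a = min y (y + h)" and "b = max y (y + h)"
        have ab: "a \<le> b" "b - a = \<bar>h\<bar>" "{a<..b} \<subseteq> cball y \<bar>h\<bar>"
          by (auto simp: a_def b_def dist_real_def)
        have b: "measure (U r) (cball y \<bar>h\<bar>) \<le> e / 4 * \<bar>h\<bar>" "measure V (cball y \<bar>h\<bar>) \<le> e / 4 * \<bar>h\<bar>"
          "measure (W s n) (cball y \<bar>h\<bar>) \<le> e / 4 * \<bar>h\<bar>" "\<bar>h\<bar> < 1"
          using d(2)[rule_format, of "\<bar>h\<bar>"] h by simp_all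
        have mono: "measure (U r) {a<..b} \<le> measure (U r) (cball y \<bar>h\<bar>)"
          "measure V {a<..b} \<le> measure V (cball y \<bar>h\<bar>)"
          "measure (W s n) {a<..b} \<le> measure (W s n) (cball y \<bar>h\<bar>)"
          using finU[OF r0] finV finW ab(3)
          by (auto intro!: finite_measure.finite_measure_mono simp: finite_borel_measure_def)
        have "measure M {..b} = measure M {..a} + measure M {a<..b}"
          using ab(1) M_is_borel by (subst finite_measure_Union[symmetric]) (auto simp: ivl_disj_un)
        then have q: "(measure M {..y + h} - measure M {..y}) / h = measure M {a<..b} / \<bar>h\<bar>"
          using h(1) by (cases "0 < h") (simp_all add: a_def b_def field_simps)
        have "measure M {a<..b} \<le> (real_of_rat r + e / 2) * \<bar>h\<bar>"
          using upper[OF ab(1) r0] b(1,2) mono(1,2) unfolding ab(2) distrib_right by linarith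
        also have "\<dots> < (g y + e) * \<bar>h\<bar>"
          using r h_pos by (intro mult_strict_right_mono) linarith+
        finally have 1: "measure M {a<..b} / \<bar>h\<bar> < g y + e"
          using h_pos by (simp only: pos_divide_less_eq)
        have "{a<..b} \<subseteq> {- real n..real n}"
          using n b(4) by (auto simp: a_def b_def)
        then have "(real_of_rat s - e / 4) * \<bar>h\<bar> \<le> measure M {a<..b}"
          using lower[OF ab(1), of n s] b(3) mono(3) unfolding ab(2) left_diff_distrib by linarith
        moreover have "(g y - e) * \<bar>h\<bar> < (real_of_rat s - e / 4) * \<bar>h\<bar>"
          using s h_pos \<open>0 < e\<close> by (intro mult_strict_right_mono) linarith+
        ultimately have 2: "g y - e < measure M {a<..b} / \<bar>h\<bar>"
          using h_pos by (simp only: pos_less_divide_eq)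
        show ?thesis
          unfolding q real_norm_def using 1 2 by linarith
      qed
      with d(1) show "\<exists>d>0. \<forall>h. h \<noteq> 0 \<and> norm (h - 0) < d \<longrightarrow>
          norm ((measure M {..y + h} - measure M {..y}) / h - g y) < e"
        by blast
    qed
  qed
qed

end

section \<open>Reduction to rational test points\<close>

text \<open>A negative value at \<open>z\<close> would persist just to the right of
  \<open>z\<close>, where some translate \<open>y + real_of_rat r\<close> lies. The shift by
  \<open>y\<close> permits rational increments from an arbitrary real base point.\<close>

lemma at_right_rational_nonneg:
  fixes \<phi> :: "real \<Rightarrow> real"
  assumes lim: "(\<phi> \<longlongrightarrow> \<phi> z) (at_right z)" and "z < b"
    and nonneg: "\<And>r. z < y + real_of_rat r \<Longrightarrow> y + real_of_rat r < b \<Longrightarrow> 0 \<le> \<phi> (y + real_of_rat r)"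
  shows "0 \<le> \<phi> z"
proof (rule ccontr)
  assume "\<not> 0 \<le> \<phi> z"
  then have "\<forall>\<^sub>F w in at_right z. \<phi> w < 0"
    using order_tendstoD(2)[OF lim] by simp
  then obtain b' where b': "z < b'" "\<forall>w>z. w < b' \<longrightarrow> \<phi> w < 0"
    unfolding eventually_at_right_field by blast
  have "z - y < min b b' - y"
    using \<open>z < b\<close> b'(1) by simp
  then obtain r where "z - y < real_of_rat r" "real_of_rat r < min b b' - y"
    using of_rat_dense by blast
  then have r: "z < y + real_of_rat r" "y + real_of_rat r < b" "y + real_of_rat r < b'"
    by linarith+
  show False
    using nonneg[OF r(1,2)] b'(2)[rule_format, OF r(1,3)] by linarith
qed

text \<open>Written without division, the derivative estimate compares right continuous functions of
  the end point, so it extends from rational increments to all small ones. Only countably many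
  conditions remain, which later makes the set of good points measurable.\<close>

lemma has_real_derivative_iff_rational:
  fixes F :: "real \<Rightarrow> real"
  assumes right_cont: "\<And>a. continuous (at_right a) F"
  shows "(F has_real_derivative d) (at y) \<longleftrightarrow>
    (\<forall>n. \<exists>m. \<forall>r. \<bar>real_of_rat r\<bar> < inverse (real (Suc m)) \<longrightarrow>
      \<bar>F (y + real_of_rat r) - F y - d * real_of_rat r\<bar> \<le> inverse (real (Suc n)) * \<bar>real_of_rat r\<bar>)"
    (is "?L \<longleftrightarrow> ?R")
proof
  assume ?L
  then have L: "\<exists>\<delta>>0. \<forall>z. \<bar>z - y\<bar> < \<delta> \<longrightarrow> \<bar>F z - F y - d * (z - y)\<bar> \<le> e * \<bar>z - y\<bar>" if "0 < e" for e
    using that unfolding has_field_derivative_def has_derivative_at_alt real_norm_def by blast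
  show ?R
  proof
    fix n
    obtain \<delta> where \<delta>: "0 < \<delta>" "\<forall>z. \<bar>z - y\<bar> < \<delta> \<longrightarrow> \<bar>F z - F y - d * (z - y)\<bar> \<le> inverse (real (Suc n)) * \<bar>z - y\<bar>"
      using L[of "inverse (real (Suc n))"] by auto
    obtain m where "inverse (real (Suc m)) < \<delta>"
      using reals_Archimedean[OF \<delta>(1)] by blast
    then show "\<exists>m. \<forall>r. \<bar>real_of_rat r\<bar> < inverse (real (Suc m)) \<longrightarrow>
      \<bar>F (y + real_of_rat r) - F y - d * real_of_rat r\<bar> \<le> inverse (real (Suc n)) * \<bar>real_of_rat r\<bar>"
      using \<delta>(2)[rule_format, of "y + real_of_rat r" for r]
      by (intro exI[of _ m]) (metis add_diff_cancel_left' less_trans)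
  qed
next
  assume R: ?R
  show ?L
    unfolding has_field_derivative_def has_derivative_at_alt real_norm_def
  proof (intro conjI allI impI)
    show "bounded_linear ((*) d)"
      by (rule bounded_linear_mult_right)
    fix e :: real assume "0 < e"
    then obtain n where n: "inverse (real (Suc n)) < e"
      using reals_Archimedean by blast
    obtain m where m: "\<And>r. \<bar>real_of_rat r\<bar> < inverse (real (Suc m)) \<Longrightarrow>
      \<bar>F (y + real_of_rat r) - F y - d * real_of_rat r\<bar> \<le> inverse (real (Suc n)) * \<bar>real_of_rat r\<bar>"
      using R by blast
    have "\<bar>F z - F y - d * (z - y)\<bar> \<le> e * \<bar>z - y\<bar>" if z: "\<bar>z - y\<bar> < inverse (real (Suc m))" for z
    proof -
      \<comment> \<open>The slack in the estimate at \<open>w\<close>: it is right continuous, and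
        \<open>m\<close> makes it nonnegative at small rational increments.\<close>
      define \<phi> where "\<phi> w = inverse (real (Suc n)) * \<bar>w - y\<bar> - \<bar>F w - F y - d * (w - y)\<bar>" for w
      have "(F \<longlongrightarrow> F z) (at_right z)"
        using right_cont by (simp add: continuous_within)
      then have "(\<phi> \<longlongrightarrow> \<phi> z) (at_right z)"
        unfolding \<phi>_def by (intro tendsto_intros)
      then have "0 \<le> \<phi> z"
      proof (rule at_right_rational_nonneg)
        show "z < y + inverse (real (Suc m))"
          using z by linarith
        show "0 \<le> \<phi> (y + real_of_rat r)"
          if "z < y + real_of_rat r" "y + real_of_rat r < y + inverse (real (Suc m))" for r
        proof -
          have "\<bar>real_of_rat r\<bar> < inverse (real (Suc m))"
            using that z by linarith
          from m[OF this] show ?thesis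
            unfolding \<phi>_def add_diff_cancel_left' by linarith
        qed
      qed
      moreover have "inverse (real (Suc n)) * \<bar>z - y\<bar> \<le> e * \<bar>z - y\<bar>"
        using n by (intro mult_right_mono) auto
      ultimately show ?thesis
        unfolding \<phi>_def by linarith
    qed
    then show "\<exists>\<delta>>0. \<forall>z. \<bar>z - y\<bar> < \<delta> \<longrightarrow> \<bar>F z - F y - d * (z - y)\<bar> \<le> e * \<bar>z - y\<bar>"
      by (intro exI[of _ "inverse (real (Suc m))"]) simp
  qed
qed

text \<open>Minus the absolute difference of the distribution functions is right continuous and 0 at
  the rationals, hence nonnegative everywhere. With countably many tests, identities valid for
  almost every \<open>x\<close> at each test set can be merged into an identity of measures for
  almost every \<open>x\<close>.\<close>

lemma finite_borel_measure_eqI_rational: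
  assumes "finite_borel_measure M" "finite_borel_measure N"
    and eq: "\<And>r. measure M {..real_of_rat r} = measure N {..real_of_rat r}"
  shows "M = N"
proof (rule cdf_unique'[OF assms(1,2)])
  show "cdf M = cdf N"
  proof
    fix z
    have "(cdf M \<longlongrightarrow> cdf M z) (at_right z)" "(cdf N \<longlongrightarrow> cdf N z) (at_right z)"
      using assms(1,2)[THEN finite_borel_measure.cdf_is_right_cont, of z] by (simp_all add: continuous_within)
    then have "((\<lambda>w. - \<bar>cdf M w - cdf N w\<bar>) \<longlongrightarrow> - \<bar>cdf M z - cdf N z\<bar>) (at_right z)"
      by (intro tendsto_intros)
    then have "0 \<le> - \<bar>cdf M z - cdf N z\<bar>"
      by (rule at_right_rational_nonneg[where y = 0 and b = "z + 1"]) (simp_all add: cdf_def eq)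
    then show "cdf M z = cdf N z"
      by simp
  qed
qed

section \<open>Kernels on the whole line\<close>

text \<open>The half-lines \<open>{..snd z}\<close> are the sections of one measurable set in the
  product, and a kernel evaluated along such sections is measurable.\<close>

lemma measurable_kernel_cdf:
  fixes \<kappa> :: "real \<Rightarrow> real measure"
  assumes \<kappa>: "\<kappa> \<in> M \<rightarrow>\<^sub>M subprob_algebra borel"
  shows "(\<lambda>z. measure (\<kappa> (fst z)) {..snd z}) \<in> borel_measurable (M \<Otimes>\<^sub>M borel)"
proof (rule measure_measurable_subprob_algebra2)
  have "(SIGMA z:space (M \<Otimes>\<^sub>M (borel :: real measure)). {..snd z}) =
      {w \<in> space ((M \<Otimes>\<^sub>M (borel :: real measure)) \<Otimes>\<^sub>M borel). snd w \<le> snd (fst w)}"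
    by (auto simp: space_pair_measure)
  also have "\<dots> \<in> sets ((M \<Otimes>\<^sub>M borel) \<Otimes>\<^sub>M borel)"
    by measurable
  finally show "(SIGMA z:space (M \<Otimes>\<^sub>M (borel :: real measure)). {..snd z}) \<in> sets ((M \<Otimes>\<^sub>M borel) \<Otimes>\<^sub>M borel)" .
  show "(\<lambda>z. \<kappa> (fst z)) \<in> M \<Otimes>\<^sub>M borel \<rightarrow>\<^sub>M subprob_algebra borel"
    using measurable_compose[OF measurable_fst \<kappa>] .
qed

text \<open>The hypothesis \<open>eq\<close> disintegrates: for almost every \<open>x\<close>, the
  measure \<open>\<kappa> x\<close> off the section of \<open>N\<close> has density
  \<open>g (x, \<cdot>)\<close>. The result on the line then applies for each such \<open>x\<close>,
  and Fubini collects the sections.\<close>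

lemma AE_kernel_has_real_derivative:
  fixes \<kappa> :: "real \<Rightarrow> real measure" and g :: "real \<times> real \<Rightarrow> real"
  assumes \<kappa>: "\<kappa> \<in> borel \<rightarrow>\<^sub>M subprob_algebra borel"
    and g [measurable]: "g \<in> borel_measurable (borel \<Otimes>\<^sub>M borel)" and g_nonneg: "\<And>z. 0 \<le> g z"
    and N: "N \<in> null_sets (lborel \<Otimes>\<^sub>M lborel)"
    and eq: "\<And>A B. A \<in> sets borel \<Longrightarrow> B \<in> sets borel \<Longrightarrow>
      (\<integral>\<^sup>+x\<in>A. emeasure (\<kappa> x) (B - Pair x -` N) \<partial>lborel) =
      (\<integral>\<^sup>+x\<in>A. (\<integral>\<^sup>+y\<in>B. ennreal (g (x, y)) \<partial>lborel) \<partial>lborel)"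
  shows "AE z in lborel \<Otimes>\<^sub>M lborel.
    ((\<lambda>v. measure (\<kappa> (fst z)) {..v}) has_real_derivative g z) (at (snd z))"
proof -
  have sets_\<kappa>: "sets (\<kappa> x) = sets borel" and sub: "subprob_space (\<kappa> x)" for x
    using measurable_space[OF \<kappa>, of x] by (auto simp: space_subprob_algebra)
  have fin: "finite_borel_measure (\<kappa> x)" for x
    using subprob_space.subprob_emeasure_le_1[OF sub, of x UNIV] le_less_trans
    by (intro finite_borel_measureI sets_\<kappa>) fastforce
  have N_sets [measurable]: "N \<in> sets (borel \<Otimes>\<^sub>M borel)"
    using N by (auto cong: sets_pair_measure_cong)
  have Nx [measurable]: "Pair x -` N \<in> sets borel" for x
    by (rule sets_Pair1[OF N_sets])
  \<comment> \<open>For fixed \<open>B\<close>, letting \<open>A\<close> vary shows that both sides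
    are densities of the same measure in \<open>x\<close>, so they agree almost everywhere.\<close>
  have AE_eq: "AE x in lborel. emeasure (\<kappa> x) (B - Pair x -` N) = (\<integral>\<^sup>+y\<in>B. ennreal (g (x, y)) \<partial>lborel)"
    if [measurable]: "B \<in> sets borel" for B
  proof (rule sigma_finite_measure.density_unique[OF sigma_finite_lborel])
    have "(SIGMA x:space borel. B - Pair x -` N) = {z \<in> space (borel \<Otimes>\<^sub>M borel). snd z \<in> B \<and> z \<notin> N}"
      by (auto simp: space_pair_measure)
    also have "\<dots> \<in> sets (borel \<Otimes>\<^sub>M borel)"
      by measurable
    finally have "(\<lambda>x. emeasure (\<kappa> x) (B - Pair x -` N)) \<in> borel_measurable borel"
      by (rule emeasure_measurable_subprob_algebra2[OF _ \<kappa>])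
    then show 1: "(\<lambda>x. emeasure (\<kappa> x) (B - Pair x -` N)) \<in> borel_measurable lborel"
      by simp
    show 2: "(\<lambda>x. \<integral>\<^sup>+y\<in>B. ennreal (g (x, y)) \<partial>lborel) \<in> borel_measurable lborel"
      by measurable
    show "density lborel (\<lambda>x. emeasure (\<kappa> x) (B - Pair x -` N)) =
        density lborel (\<lambda>x. \<integral>\<^sup>+y\<in>B. ennreal (g (x, y)) \<partial>lborel)"
    proof (rule measure_eqI)
      fix A assume "A \<in> sets (density lborel (\<lambda>x. emeasure (\<kappa> x) (B - Pair x -` N)))"
      then have "A \<in> sets borel"
        by simp
      then show "emeasure (density lborel (\<lambda>x. emeasure (\<kappa> x) (B - Pair x -` N))) A =
          emeasure (density lborel (\<lambda>x. \<integral>\<^sup>+y\<in>B. ennreal (g (x, y)) \<partial>lborel)) A"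
        using 1 2 that eq[of A B] by (simp add: emeasure_density)
    qed simp
  qed
  have AE_rat: "AE x in lborel. \<forall>r. emeasure (\<kappa> x) ({..real_of_rat r} - Pair x -` N) =
      (\<integral>\<^sup>+y\<in>{..real_of_rat r}. ennreal (g (x, y)) \<partial>lborel)"
    unfolding AE_all_countable by (intro allI AE_eq) simp
  have AE_null: "AE x in lborel. AE y in lborel. (x, y) \<notin> N"
    using lborel_pair.AE_pair[OF AE_not_in[OF N]] by simp
  have AE_AE: "AE x in lborel. AE y in lborel.
      ((\<lambda>v. measure (\<kappa> x) {..v}) has_real_derivative g (x, y)) (at y)"
    \<comment> \<open>Besides the rational half-lines, the case \<open>B = UNIV\<close> is kept: it
      shows that the measure with density \<open>g (x, \<cdot>)\<close> has finite mass.\<close>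
    using AE_rat AE_eq[OF sets.top[of borel, unfolded space_borel]] AE_null
  proof eventually_elim
    case (elim x)
    interpret \<kappa>: finite_borel_measure "\<kappa> x" by (rule fin)
    have gx [measurable]: "(\<lambda>y. g (x, y)) \<in> borel_measurable borel"
      by measurable
    have Nx0: "Pair x -` N \<in> null_sets lborel"
      using elim(3) by (subst AE_iff_null_sets) auto
    have d1: "emeasure (density (\<kappa> x) (indicator (- Pair x -` N))) B = emeasure (\<kappa> x) (B - Pair x -` N)"
      if "B \<in> sets borel" for B
      using that Nx[of x] sets_\<kappa> by (simp add: emeasure_restricted Diff_eq Int_commute)
    have d2: "emeasure (density lborel (\<lambda>y. ennreal (g (x, y)))) B = (\<integral>\<^sup>+y\<in>B. ennreal (g (x, y)) \<partial>lborel)"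
      if "B \<in> sets borel" for B
      using that by (simp add: emeasure_density)
    have f1: "finite_borel_measure (density (\<kappa> x) (indicator (- Pair x -` N)))"
      by (intro finite_borel_measureI) (simp_all add: sets_\<kappa> d1 less_top[symmetric])
    have f2: "finite_borel_measure (density lborel (\<lambda>y. ennreal (g (x, y))))"
      by (intro finite_borel_measureI) (simp_all only: d2 sets.top[of borel, unfolded space_borel] elim(2)[symmetric]
        sets_density sets_lborel infinity_ennreal_def less_top[symmetric] \<kappa>.emeasure_finite[unfolded infinity_ennreal_def] not_False_eq_True)
    have "density (\<kappa> x) (indicator (- Pair x -` N)) = density lborel (\<lambda>y. ennreal (g (x, y)))"
      using elim(1) by (intro finite_borel_measure_eqI_rational f1 f2) (simp add: measure_def d1 d2)
    then show ?case
      by (rule \<kappa>.AE_has_real_derivative_distribution[OF gx g_nonneg Nx0])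
  qed
  \<comment> \<open>Passing from almost every section to almost every point needs a measurable set
    of good points; the rational criterion supplies it.\<close>
  have "{z \<in> space (lborel \<Otimes>\<^sub>M lborel). ((\<lambda>v. measure (\<kappa> (fst z)) {..v}) has_real_derivative g z) (at (snd z))} =
    {z \<in> space (borel \<Otimes>\<^sub>M borel). \<forall>n. \<exists>m. \<forall>r. \<bar>real_of_rat r\<bar> < inverse (real (Suc m)) \<longrightarrow>
      \<bar>measure (\<kappa> (fst z)) {..snd z + real_of_rat r} - measure (\<kappa> (fst z)) {..snd z} - g z * real_of_rat r\<bar>
        \<le> inverse (real (Suc n)) * \<bar>real_of_rat r\<bar>}"
    using finite_borel_measure.cdf_is_right_cont[OF fin]
    by (subst has_real_derivative_iff_rational) (simp_all add: cdf_def[abs_def] space_pair_measure)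
  also have "\<dots> \<in> sets (borel \<Otimes>\<^sub>M borel)"
  proof -
    have [measurable]: "(\<lambda>z. measure (\<kappa> (fst z)) {..snd z + c}) \<in> borel_measurable (borel \<Otimes>\<^sub>M borel)" for c
      using measurable_compose[OF _ measurable_kernel_cdf[OF \<kappa>], of "\<lambda>z. (fst z, snd z + c)" "borel \<Otimes>\<^sub>M borel"]
      by simp
    have [measurable]: "(\<lambda>z. measure (\<kappa> (fst z)) {..snd z}) \<in> borel_measurable (borel \<Otimes>\<^sub>M borel)"
      by (rule measurable_kernel_cdf[OF \<kappa>])
    show ?thesis
      by measurable
  qed
  finally have "{z \<in> space (lborel \<Otimes>\<^sub>M lborel).
      ((\<lambda>v. measure (\<kappa> (fst z)) {..v}) has_real_derivative g z) (at (snd z))} \<in> sets (lborel \<Otimes>\<^sub>M lborel)"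
    by (simp cong: sets_pair_measure_cong)
  then show ?thesis
    using AE_AE by (rule lborel_pair.AE_pair_measure[where P = "\<lambda>z. ((\<lambda>v. measure (\<kappa> (fst z)) {..v}) has_real_derivative g z) (at (snd z))", unfolded fst_conv snd_conv])
qed

section \<open>The density off a null set carrying the singular part\<close>

text \<open>Take for \<open>N\<close> the complement of the set on which the singular part vanishes.
  Off \<open>N\<close> only the absolutely continuous part survives, and that part does not notice
  the removal of \<open>N\<close>.\<close>

lemma ac_density_null_set:
  assumes ac: "ac_density M \<mu> f" and "finite_measure \<mu>"
  obtains N where "N \<in> null_sets M" "AE z in M. 0 \<le> f z"
    "\<And>G. G \<in> sets M \<Longrightarrow> emeasure \<mu> (G - N) = (\<integral>\<^sup>+z\<in>G. ennreal (f z) \<partial>M)"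
proof -
  interpret finite_measure \<mu> by fact
  obtain \<mu>a \<mu>s where int: "integrable M f" and dec: "lebesgue_decomposition M \<mu> \<mu>a \<mu>s"
    and f: "\<And>G. G \<in> sets M \<Longrightarrow> measure \<mu>a G = (LINT z:G|M. f z)"
    using ac by (auto simp: ac_density_def)
  have sets: "sets \<mu> = sets M" "sets \<mu>a = sets M" "sets \<mu>s = sets M"
    and add: "\<And>G. G \<in> sets M \<Longrightarrow> emeasure \<mu> G = emeasure \<mu>a G + emeasure \<mu>s G"
    and cont: "absolutely_continuous M \<mu>a"
    using dec by (auto simp: lebesgue_decomposition_def)
  obtain S where S: "S \<in> sets M" "emeasure \<mu>s S = 0" "emeasure M (space M - S) = 0"
    using dec by (auto simp: lebesgue_decomposition_def mutually_singular_def)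
  have f_meas [measurable]: "f \<in> borel_measurable M"
    using int by simp
  define N where "N = space M - S"
  have N: "N \<in> null_sets M"
    using S by (auto simp: N_def)
  have nonneg: "AE z in M. 0 \<le> f z"
  proof -
    \<comment> \<open>The integral of \<open>f\<close> over \<open>{f < 0}\<close> is a value of
      \<open>measure\<close>, hence nonnegative; being also nonpositive, it is 0, so this set is
      null.\<close>
    define G where "G = {z \<in> space M. f z < 0}"
    have G [measurable]: "G \<in> sets M"
      unfolding G_def by measurable
    have int': "integrable M (\<lambda>z. - (indicator G z * f z))"
      using integrable_real_mult_indicator[OF G int] by (simp add: mult.commute)
    have nn: "AE z in M. 0 \<le> - (indicator G z * f z)"
      by (auto simp: G_def indicator_def)
    have "0 \<le> (LINT z:G|M. f z)"
      unfolding f[OF G, symmetric] by (rule measure_nonneg)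
    moreover have "0 \<le> integral\<^sup>L M (\<lambda>z. - (indicator G z * f z))"
      using nn by (rule integral_nonneg_AE)
    ultimately have "integral\<^sup>L M (\<lambda>z. - (indicator G z * f z)) = 0"
      by (simp add: set_lebesgue_integral_def)
    then have "AE z in M. - (indicator G z * f z) = 0"
      using integral_nonneg_eq_0_iff_AE[OF int' nn] by simp
    then show ?thesis
      using AE_space by eventually_elim (auto simp: G_def indicator_def split: if_splits)
  qed
  have "emeasure \<mu> (G - N) = (\<integral>\<^sup>+z\<in>G. ennreal (f z) \<partial>M)" if G [measurable]: "G \<in> sets M" for G
  proof -
    have G': "G - N \<in> sets M"
      using G N by auto
    have "G - N \<subseteq> S"
      using sets.sets_into_space[OF G] by (auto simp: N_def)
    then have "emeasure \<mu>s (G - N) = 0"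
      by (rule emeasure_eq_0[rotated 2]) (use S in \<open>simp_all add: sets\<close>)
    then have "emeasure \<mu> (G - N) = emeasure \<mu>a (G - N)"
      using add[OF G'] by simp
    also have "\<dots> = emeasure \<mu>a G"
      by (rule emeasure_Diff_null_set) (use N cont G in \<open>auto simp: absolutely_continuous_def sets\<close>)
    also have "\<dots> = ennreal (measure \<mu>a G)"
    \<comment> \<open>As \<open>measure\<close> is 0 on sets of infinite mass, finiteness of
      \<open>\<mu>a\<close>, inherited from \<open>\<mu>\<close>, must be checked first.\<close>
    proof (rule emeasure_eq_ennreal_measure)
      have "emeasure \<mu>a G \<le> emeasure \<mu> G"
        unfolding add[OF G] by simp
      then show "emeasure \<mu>a G \<noteq> \<top>"
        by (rule neq_top_trans[rotated]) (rule emeasure_finite[unfolded infinity_ennreal_def])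
    qed
    also have "\<dots> = ennreal (integral\<^sup>L M (\<lambda>z. indicator G z * f z))"
      by (simp add: f[OF G] set_lebesgue_integral_def)
    also have "\<dots> = (\<integral>\<^sup>+z. ennreal (indicator G z * f z) \<partial>M)"
    proof (rule nn_integral_eq_integral[symmetric])
      show "integrable M (\<lambda>z. indicator G z * f z)"
        using integrable_real_mult_indicator[OF G int] by (simp add: mult.commute)
      show "AE z in M. 0 \<le> indicator G z * f z"
        using nonneg by eventually_elim simp
    qed
    also have "\<dots> = (\<integral>\<^sup>+z\<in>G. ennreal (f z) \<partial>M)"
      by (intro nn_integral_cong) (simp add: indicator_def)
    finally show ?thesis .
  qed
  with N nonneg show thesis
    by (rule that)
qed

section \<open>Passage between the unit square and the plane\<close>

lemma unit_square_borel [measurable]: "{0..1::real} \<times> {0..1::real} \<in> sets borel"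
  by (intro borel_closed closed_Times) auto

text \<open>Kernel and density are extended by 0 to the line and the plane. A two-sided derivative
  there restricts to a derivative within \<open>{0..1}\<close>.\<close>

lemma AE_unit_kernel_has_real_derivative:
  fixes K :: "real \<Rightarrow> real measure" and f :: "real \<times> real \<Rightarrow> real"
  assumes K: "K \<in> unit_leb \<rightarrow>\<^sub>M prob_algebra unit_leb"
    and f: "f \<in> borel_measurable square_leb" and nonneg: "AE z in square_leb. 0 \<le> f z"
    and N: "N \<in> null_sets square_leb"
    and eq: "\<And>G. G \<in> sets square_leb \<Longrightarrow>
      (\<integral>\<^sup>+x. emeasure (K x) {y. (x, y) \<in> G - N} \<partial>unit_leb) = (\<integral>\<^sup>+z\<in>G. ennreal (f z) \<partial>square_leb)"
  shows "AE z in square_leb.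
    ((\<lambda>v. measure (K (fst z)) {0..v}) has_real_derivative f z) (at (snd z) within {0..1})"
proof -
  let ?I = "{0..1::real}"
  let ?Q = "?I \<times> ?I"
  have subK: "sets (K x) = sets unit_leb" "prob_space (K x)" if "x \<in> ?I" for x
    using measurable_space[OF K, of x] that by (auto simp: space_prob_algebra)
  have id [measurable]: "(\<lambda>y. y) \<in> unit_leb \<rightarrow>\<^sub>M borel"
    by (intro measurable_restrict_space1) simp
  \<comment> \<open>The null measure outside the interval is why the preceding results are stated
    for subprobability kernels.\<close>
  define \<kappa> where "\<kappa> x = (if x \<in> ?I then distr (K x) borel (\<lambda>y. y) else null_measure borel)" for x
  have \<kappa>: "\<kappa> \<in> borel \<rightarrow>\<^sub>M subprob_algebra borel"
  proof -
    have "(\<lambda>x. distr (K x) borel (\<lambda>y. y)) \<in> unit_leb \<rightarrow>\<^sub>M subprob_algebra borel"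
      using measurable_compose[OF measurable_prob_algebraD[OF K] measurable_distr[OF id]] .
    moreover have "null_measure borel \<in> space (subprob_algebra (borel :: real measure))"
      by (auto simp: space_subprob_algebra intro!: subprob_spaceI)
    ultimately have "\<kappa> \<in> lborel \<rightarrow>\<^sub>M subprob_algebra borel"
      unfolding \<kappa>_def by (subst measurable_restrict_space_iff[symmetric]) auto
    then show ?thesis
      by simp
  qed
  have e\<kappa>: "emeasure (\<kappa> x) B = emeasure (K x) (B \<inter> ?I)" if "x \<in> ?I" "B \<in> sets borel" for x B
  proof -
    have sp: "space (K x) = ?I"
      using sets_eq_imp_space_eq[OF subK(1)[OF that(1)]] by (simp add: space_restrict_space)
    have "(\<lambda>y. y) \<in> K x \<rightarrow>\<^sub>M borel"
      using id subK(1)[OF that(1)] by (simp cong: measurable_cong_sets)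
    then show ?thesis
      using that by (simp add: \<kappa>_def emeasure_distr sp)
  qed
  \<comment> \<open>Taking \<open>max 0\<close> makes the density nonnegative everywhere; integrals
    through \<open>ennreal\<close> do not change, and \<open>g\<close> equals \<open>f\<close>
    almost everywhere on the square.\<close>
  define g where "g z = (if z \<in> ?Q then max 0 (f z) else 0)" for z
  have f': "(\<lambda>z. if z \<in> ?Q then f z else 0) \<in> borel_measurable borel"
    using f unit_square_borel by (subst (asm) measurable_restrict_space_iff) auto
  have "g = (\<lambda>z. max 0 (if z \<in> ?Q then f z else 0))"
    by (auto simp: g_def)
  then have g: "g \<in> borel_measurable (borel \<Otimes>\<^sub>M borel)"
    using f' by (simp add: borel_prod)
  have Q_sets: "?Q \<inter> space lborel \<in> sets lborel"
    using unit_square_borel by simp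
  have NQ: "N \<subseteq> ?Q" and N0: "N \<in> null_sets lborel"
    using N Q_sets by (auto simp: null_sets_restrict_space)
  have Nb: "N \<in> sets (borel \<Otimes>\<^sub>M borel)"
    using null_setsD2[OF N0] unfolding borel_prod by simp
  have main: "AE z in lborel \<Otimes>\<^sub>M lborel.
      ((\<lambda>v. measure (\<kappa> (fst z)) {..v}) has_real_derivative g z) (at (snd z))"
  proof (rule AE_kernel_has_real_derivative[OF \<kappa> g])
    show "0 \<le> g z" for z
      by (simp add: g_def)
    show "N \<in> null_sets (lborel \<Otimes>\<^sub>M lborel)"
      using N0 by (simp add: lborel_prod)
    fix A B :: "real set"
    assume A: "A \<in> sets borel" and B: "B \<in> sets borel"
    define G where "G = (A \<times> B) \<inter> ?Q"
    have AB: "A \<times> B \<in> sets borel"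
      using A B by (simp add: borel_prod[symmetric])
    then have G: "G \<in> sets square_leb"
      using Q_sets by (auto simp: sets_restrict_space G_def)
    have "(\<integral>\<^sup>+x\<in>A. emeasure (\<kappa> x) (B - Pair x -` N) \<partial>lborel) =
        (\<integral>\<^sup>+x. emeasure (K x) {y. (x, y) \<in> G - N} * indicator ?I x \<partial>lborel)"
    proof (rule nn_integral_cong)
      fix x :: real
      show "emeasure (\<kappa> x) (B - Pair x -` N) * indicator A x =
          emeasure (K x) {y. (x, y) \<in> G - N} * indicator ?I x"
      proof (cases "x \<in> ?I")
        case True
        have "{y. (x, y) \<in> G - N} = (if x \<in> A then (B - Pair x -` N) \<inter> ?I else {})"
          using True by (auto simp: G_def)
        then show ?thesis
          using True e\<kappa>[OF True] B sets_Pair1[OF Nb, of x] by auto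
      qed (simp add: \<kappa>_def del: atLeastAtMost_iff)
    qed
    also have "\<dots> = (\<integral>\<^sup>+x. emeasure (K x) {y. (x, y) \<in> G - N} \<partial>unit_leb)"
      by (subst nn_integral_restrict_space) auto
    also have "\<dots> = (\<integral>\<^sup>+z\<in>G. ennreal (f z) \<partial>square_leb)"
      by (rule eq[OF G])
    also have "\<dots> = (\<integral>\<^sup>+z. ennreal (f z) * indicator G z * indicator ?Q z \<partial>lborel)"
      using Q_sets by (subst nn_integral_restrict_space) auto
    also have "\<dots> = (\<integral>\<^sup>+z. ennreal (g z) * indicator (A \<times> B) z \<partial>lborel)"
      by (intro nn_integral_cong) (auto simp: g_def G_def indicator_def max_def ennreal_neg)
    also have "\<dots> = (\<integral>\<^sup>+z. ennreal (g z) * indicator (A \<times> B) z \<partial>(lborel \<Otimes>\<^sub>M lborel))"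
      by (simp add: lborel_prod)
    also have "\<dots> = (\<integral>\<^sup>+x. \<integral>\<^sup>+y. ennreal (g (x, y)) * indicator (A \<times> B) (x, y) \<partial>lborel \<partial>lborel)"
      using g A B by (subst sigma_finite_measure.nn_integral_fst[OF sigma_finite_lborel, symmetric]) auto
    also have "\<dots> = (\<integral>\<^sup>+x\<in>A. (\<integral>\<^sup>+y\<in>B. ennreal (g (x, y)) \<partial>lborel) \<partial>lborel)"
      by (intro nn_integral_cong) (auto simp: indicator_def)
    finally show "(\<integral>\<^sup>+x\<in>A. emeasure (\<kappa> x) (B - Pair x -` N) \<partial>lborel) =
        (\<integral>\<^sup>+x\<in>A. (\<integral>\<^sup>+y\<in>B. ennreal (g (x, y)) \<partial>lborel) \<partial>lborel)" .
  qed
  then have "AE z in square_leb. z \<in> ?Q \<and>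
      ((\<lambda>v. measure (\<kappa> (fst z)) {..v}) has_real_derivative g z) (at (snd z))"
    unfolding AE_restrict_space_iff[OF Q_sets] lborel_prod by eventually_elim blast
  then show ?thesis
    using nonneg
  proof eventually_elim
    case (elim z)
    then have z: "fst z \<in> ?I" "snd z \<in> ?I" "g z = f z"
      by (auto simp: g_def)
    \<comment> \<open>The measure \<open>K (fst z)\<close> lives on the unit interval, so negative
      arguments contribute nothing.\<close>
    have eq: "measure (\<kappa> (fst z)) {..v} = measure (K (fst z)) {0..v}" if "v \<in> ?I" for v
    proof -
      have I: "{..v} \<inter> ?I = {0..v}"
        using that by auto
      show ?thesis
        unfolding measure_def e\<kappa>[OF z(1) borel_closed[OF closed_atMost]] I ..
    qed
    have "((\<lambda>v. measure (\<kappa> (fst z)) {..v}) has_real_derivative f z) (at (snd z))"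
      using elim(1) unfolding z(3) by blast
    then have "((\<lambda>v. measure (\<kappa> (fst z)) {..v}) has_real_derivative f z) (at (snd z) within ?I)"
      by (rule has_field_derivative_at_within)
    then show ?case
      by (rule has_field_derivative_transform_within[OF _ zero_less_one z(2)]) (rule eq)
  qed
qed

section \<open>Reflection of the square\<close>

lemma measurable_swap_borel: "prod.swap \<in> borel \<rightarrow>\<^sub>M (borel :: (real \<times> real) measure)"
  unfolding prod.swap_def[abs_def] borel_prod[symmetric] by measurable

lemma measurable_swap_square_leb: "prod.swap \<in> square_leb \<rightarrow>\<^sub>M square_leb"
  using measurable_swap_borel by (intro measurable_restrict_space3) auto

text \<open>The square is symmetric, and product Lebesgue measure is invariant under exchange of its
  factors.\<close>

lemma distr_swap_square_leb: "distr square_leb square_leb prod.swap = square_leb"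
proof (rule measure_eqI)
  fix G assume "G \<in> sets (distr square_leb square_leb prod.swap)"
  then have G: "G \<in> sets square_leb"
    by simp
  let ?Q = "{0..1::real} \<times> {0..1::real}"
  have Q: "?Q \<inter> space lborel \<in> sets lborel"
    using unit_square_borel by simp
  have Gb: "G \<in> sets borel" "G \<subseteq> ?Q"
    using G Q by (auto simp: sets_restrict_space_iff)
  have swap: "(\<lambda>(x, y). (y, x)) = (prod.swap :: real \<times> real \<Rightarrow> _)"
    by auto
  have "emeasure (distr square_leb square_leb prod.swap) G = emeasure square_leb (prod.swap -` G \<inter> ?Q)"
    using G by (simp add: emeasure_distr[OF measurable_swap_square_leb] space_restrict_space)
  also have "prod.swap -` G \<inter> ?Q = prod.swap -` G"
    using Gb by auto
  also have "emeasure square_leb (prod.swap -` G) = emeasure lborel (prod.swap -` G)"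
    using Q Gb by (intro emeasure_restrict_space) auto
  also have "\<dots> = emeasure (distr lborel lborel prod.swap) G"
    using Gb measurable_swap_borel by (subst emeasure_distr) auto
  also have "distr lborel lborel prod.swap = (lborel :: (real \<times> real) measure)"
  proof -
    have "lborel \<Otimes>\<^sub>M lborel =
        distr (lborel \<Otimes>\<^sub>M lborel) (lborel \<Otimes>\<^sub>M lborel) (\<lambda>(x :: real, y :: real). (y, x))"
      by (rule lborel_pair.distr_pair_swap)
    then show ?thesis
      unfolding lborel_prod swap by (rule sym)
  qed
  also have "emeasure lborel G = emeasure square_leb G"
    using Q Gb by (intro emeasure_restrict_space[symmetric]) auto
  finally show "emeasure (distr square_leb square_leb prod.swap) G = emeasure square_leb G" .
qed simp

text \<open>Reflection exchanges the two marginal conditions and the sides of the rectangles, so the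
  image measure meets the description of the transposed copula's measure; uniqueness does the
  rest.\<close>

lemma copula_measure_transpose:
  assumes "copula C"
  shows "copula_measure (transpose_copula C) = distr (copula_measure C) square_leb prod.swap"
proof -
  let ?\<mu> = "copula_measure C" and ?I = "{0..1::real}"
  have \<mu>: "measure_of_copula C ?\<mu>"
    by (rule measure_of_copula_copula_measure) fact
  then have sets: "sets ?\<mu> = sets square_leb"
    by (simp add: measure_of_copula_def doubly_stochastic_def)
  have sp: "space ?\<mu> = ?I \<times> ?I"
    using sets_eq_imp_space_eq[OF sets] by (simp add: space_restrict_space)
  have swap: "prod.swap \<in> ?\<mu> \<rightarrow>\<^sub>M square_leb"
    using measurable_swap_square_leb sets by (simp cong: measurable_cong_sets)
  have rect: "emeasure (distr ?\<mu> square_leb prod.swap) (A \<times> B) = emeasure ?\<mu> (B \<times> A)"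
    if "A \<in> sets unit_leb" "B \<in> sets unit_leb" for A B
  proof -
    have AB: "A \<in> sets borel" "B \<in> sets borel" "A \<subseteq> ?I" "B \<subseteq> ?I"
      using that by (auto simp: sets_restrict_space_iff)
    then have "A \<times> B \<in> sets borel"
      by (simp add: borel_prod[symmetric])
    then have "A \<times> B \<in> sets square_leb"
      using AB unit_square_borel by (subst sets_restrict_space_iff) auto
    then have "emeasure (distr ?\<mu> square_leb prod.swap) (A \<times> B) = emeasure ?\<mu> (prod.swap -` (A \<times> B) \<inter> ?I \<times> ?I)"
      by (simp add: emeasure_distr[OF swap] sp)
    also have "prod.swap -` (A \<times> B) \<inter> ?I \<times> ?I = B \<times> A"
      using AB by auto
    finally show ?thesis .
  qed
  have I: "{0..x} \<in> sets unit_leb" if "x \<le> 1" for x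
    using that by (auto simp: sets_restrict_space_iff)
  have "measure_of_copula (transpose_copula C) (distr ?\<mu> square_leb prod.swap)"
    using \<mu> I rect unfolding measure_of_copula_def doubly_stochastic_def
    by (auto simp: measure_def transpose_copula_def)
  then show ?thesis
    unfolding copula_measure_def[of "transpose_copula C"]
    using measure_of_copula_unique by (intro the_equality) blast+
qed

section \<open>Partial derivatives of both kernels of a copula\<close>

theorem theorem3p7:
  fixes C :: "real \<Rightarrow> real \<Rightarrow> real"
    and K Kt :: "real \<Rightarrow> real measure"
    and f :: "real \<times> real \<Rightarrow> real"
  assumes "copula C"
    and "markov_kernel C K"
    and "markov_kernel (transpose_copula C) Kt"
    and "ac_density square_leb (copula_measure C) f"
  shows "AE (x, y) in square_leb.
      ((\<lambda>v. measure (K x) {0..v}) has_real_derivative f (x, y)) (at y within {0..1}) \<and>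
      ((\<lambda>u. measure (Kt y) {0..u}) has_real_derivative f (x, y)) (at x within {0..1})"
proof -
  let ?\<mu> = "copula_measure C" and ?Q = "{0..1::real} \<times> {0..1::real}"
  have "measure_of_copula C ?\<mu>"
    by (rule measure_of_copula_copula_measure) fact
  then have sets: "sets ?\<mu> = sets square_leb"
    and marg: "emeasure ?\<mu> ({0..1} \<times> {0..1}) = emeasure unit_leb {0..1}"
    by (auto simp: measure_of_copula_def doubly_stochastic_def sets_restrict_space_iff)
  have sp: "space ?\<mu> = ?Q"
    using sets_eq_imp_space_eq[OF sets] by (simp add: space_restrict_space)
  have "finite_measure ?\<mu>"
    using marg by (intro finite_measureI) (simp add: sp emeasure_restrict_space)
  then obtain N where N: "N \<in> null_sets square_leb" "AE z in square_leb. 0 \<le> f z"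
    "\<And>G. G \<in> sets square_leb \<Longrightarrow> emeasure ?\<mu> (G - N) = (\<integral>\<^sup>+z\<in>G. ennreal (f z) \<partial>square_leb)"
    using ac_density_null_set[OF assms(4)] by blast
  have f: "f \<in> borel_measurable square_leb"
    using assms(4) by (auto simp: ac_density_def)
  note swap = measurable_swap_square_leb
  have AE_swap: "AE z in square_leb. P (prod.swap z)" if "AE z in square_leb. P z" for P
    by (rule AE_distrD[OF swap]) (use that in \<open>simp only: distr_swap_square_leb\<close>)
  have "AE z in square_leb.
      ((\<lambda>v. measure (K (fst z)) {0..v}) has_real_derivative f z) (at (snd z) within {0..1})"
  proof (rule AE_unit_kernel_has_real_derivative[OF _ f N(2,1)])
    show "K \<in> unit_leb \<rightarrow>\<^sub>M prob_algebra unit_leb"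
      using assms(2) by (simp add: markov_kernel_def)
    fix G assume G: "G \<in> sets square_leb"
    then have "G - N \<in> sets square_leb"
      using N(1) by auto
    then have "(\<integral>\<^sup>+x. emeasure (K x) {y. (x, y) \<in> G - N} \<partial>unit_leb) = emeasure ?\<mu> (G - N)"
      using assms(2) unfolding markov_kernel_def by (intro sym[of "emeasure ?\<mu> (G - N)"]) blast
    also have "\<dots> = (\<integral>\<^sup>+z\<in>G. ennreal (f z) \<partial>square_leb)"
      by (rule N(3)[OF G])
    finally show "(\<integral>\<^sup>+x. emeasure (K x) {y. (x, y) \<in> G - N} \<partial>unit_leb) =
        (\<integral>\<^sup>+z\<in>G. ennreal (f z) \<partial>square_leb)" .
  qed
  \<comment> \<open>\<open>Kt\<close> conditions on the second coordinate, so \<open>z\<close>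
    stands for \<open>(y, x)\<close> here, and \<open>f\<close> and \<open>N\<close> are read
    through the reflection.\<close>
  moreover have "AE z in square_leb.
      ((\<lambda>v. measure (Kt (fst z)) {0..v}) has_real_derivative f (prod.swap z)) (at (snd z) within {0..1})"
  proof (rule AE_unit_kernel_has_real_derivative)
    let ?N = "prod.swap -` N \<inter> space square_leb"
    show "Kt \<in> unit_leb \<rightarrow>\<^sub>M prob_algebra unit_leb"
      using assms(3) by (simp add: markov_kernel_def)
    show "(\<lambda>z. f (prod.swap z)) \<in> borel_measurable square_leb"
      by (rule measurable_compose[OF swap f])
    show "AE z in square_leb. 0 \<le> f (prod.swap z)"
      by (rule AE_swap) (rule N(2))
    have "N \<in> null_sets (distr square_leb square_leb prod.swap)"
      using N(1) by (simp add: distr_swap_square_leb)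
    then show N': "?N \<in> null_sets square_leb"
      using null_sets_distr_iff[OF swap] by simp
    fix G assume G: "G \<in> sets square_leb"
    let ?G = "prod.swap -` G \<inter> space square_leb"
    have GN: "G - ?N \<in> sets square_leb"
      using G N' by auto
    have sG: "?G \<in> sets square_leb"
      using measurable_sets[OF swap G] .
    have "(\<integral>\<^sup>+x. emeasure (Kt x) {y. (x, y) \<in> G - ?N} \<partial>unit_leb) =
        emeasure (copula_measure (transpose_copula C)) (G - ?N)"
      using assms(3) GN unfolding markov_kernel_def
      by (intro sym[of "emeasure (copula_measure (transpose_copula C)) (G - ?N)"]) blast
    also have "\<dots> = emeasure ?\<mu> (prod.swap -` (G - ?N) \<inter> space ?\<mu>)"
      unfolding copula_measure_transpose[OF assms(1)]
      by (rule emeasure_distr[OF _ GN]) (use swap in \<open>simp only: measurable_cong_sets[OF sets refl]\<close>)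
    also have "prod.swap -` (G - ?N) \<inter> space ?\<mu> = ?G - N"
      by (auto simp: sp space_restrict_space)
    also have "emeasure ?\<mu> (?G - N) = (\<integral>\<^sup>+z\<in>?G. ennreal (f z) \<partial>square_leb)"
      by (rule N(3)[OF sG])
    \<comment> \<open>The double reflection puts the integrand into the form required by the change
      of variables formula.\<close>
    also have "\<dots> = (\<integral>\<^sup>+z. ennreal (f (prod.swap (prod.swap z))) * indicator G (prod.swap z) \<partial>square_leb)"
      by (intro nn_integral_cong) (simp add: indicator_def)
    also have "\<dots> = (\<integral>\<^sup>+z. ennreal (f (prod.swap z)) * indicator G z \<partial>distr square_leb square_leb prod.swap)"
      using measurable_compose[OF swap f] G by (intro nn_integral_distr[symmetric] swap) auto
    finally show "(\<integral>\<^sup>+x. emeasure (Kt x) {y. (x, y) \<in> G - ?N} \<partial>unit_leb) =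
        (\<integral>\<^sup>+z\<in>G. ennreal (f (prod.swap z)) \<partial>square_leb)"
      by (simp add: distr_swap_square_leb)
  qed
  \<comment> \<open>Reflecting once more returns to the coordinates \<open>(x, y)\<close> of the
    first derivative.\<close>
  note AE_swap[OF this]
  ultimately show ?thesis
    by eventually_elim (simp add: case_prod_beta)
qed

end
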